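(* For every $n\in\mathbb{N}$, $n\geq 1$, there exist $a_1,\ldots,a_n\in\mathbb{C}\setminus\{0\}$ such that the harmonic polynomial \[ P_n(z,\bar z)=\sum_{k=1}^{\lfloor n/2\rfloor}a_{2k}z^{2k}+\sum_{k=1}^{\lceil n/2\rceil}a_{2k-1}\bar z^{\,2k-1} \] has exactly $n^2$ distinct zeros in $\mathbb{C}$.
   Context: A zero of $P_n$ is a point $z\in\mathbb{C}$ with $P_n(z,\bar z)=0$. *)

theory Defs
  imports "HOL-Analysis.Analysis"
begin

definition harmP :: "nat \<Rightarrow> (nat \<Rightarrow> complex) \<Rightarrow> complex \<Rightarrow> complex" where
  "harmP n a z =
     (\<Sum>k = 1..n div 2. a (2*k) * z ^ (2*k))
   + (\<Sum>k = 1..(n + 1) div 2. a (2*k - 1) * (cnj z) ^ (2*k - 1))"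

end

theory Submission
  imports Defs
begin

text \<open>Pass from \<open>n\<close> to \<open>n + 1\<close> by adding a small multiple \<open>\<epsilon>\<close> of the next monomial \<open>e (n + 1)\<close>, keeping
  all zeros regular, i.e. \<open>|\<partial>P/\<partial>z| \<noteq> |\<partial>P/\<partial>cnj z|\<close>. The \<open>n\<^sup>2\<close> old zeros persist inside a fixed disc
  \<open>|z| \<le> R\<close>. In the variable \<open>w = \<epsilon> z\<close> the rescaled polynomial \<open>\<epsilon> ^ n * P (w / \<epsilon>)\<close> tends to
  \<open>a n * e n w + e (n + 1) w\<close>, whose \<open>2 n + 1\<close> nonzero zeros are regular and lie on the circle
  \<open>|w| = |a n|\<close>; they yield \<open>2 n + 1\<close> new zeros. In between, \<open>a n * e n z\<close> dominates and there are
  no zeros.\<close>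

section \<open>Real-linear maps of the complex plane\<close>

text \<open>As a real-linear map of the plane, \<open>h \<mapsto> a * h + b * cnj h\<close> has
  determinant \<open>|a|^2 - |b|^2\<close>, and \<open>L\<close> is its adjugate divided by this
  determinant.\<close>

lemma harmonic_inverse_linear:
  fixes a b u v :: complex
  assumes "norm a \<noteq> norm b"
    and L: "L = (\<lambda>u. (cnj a * u - b * cnj u) / of_real ((norm a)\<^sup>2 - (norm b)\<^sup>2))"
  shows "L (a * u + b * cnj u) = u"
    and "a * L u + b * cnj (L u) = u"
    and "norm (L u) \<le> (norm a + norm b) / \<bar>(norm a)\<^sup>2 - (norm b)\<^sup>2\<bar> * norm u"
    and "L (u - v) = L u - L v"
    and "bounded_linear L"
proof -
  define d where "d = (norm a)\<^sup>2 - (norm b)\<^sup>2"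
  have d0: "d \<noteq> 0"
    using assms(1) by (simp add: d_def power2_eq_iff_nonneg)
  have dc: "of_real d = a * cnj a - b * cnj b"
    unfolding d_def of_real_diff complex_norm_square ..
  have Ld: "L u = (cnj a * u - b * cnj u) / of_real d" for u
    by (simp add: L d_def)
  have "(cnj a * (a * u + b * cnj u) - b * cnj (a * u + b * cnj u)) = u * of_real d"
    by (simp add: dc algebra_simps)
  then show "L (a * u + b * cnj u) = u"
    using d0 by (simp add: Ld)
  have "a * (cnj a * u - b * cnj u) + b * cnj (cnj a * u - b * cnj u) = u * of_real d"
    by (simp add: dc algebra_simps)
  then show "a * L u + b * cnj (L u) = u"
    using d0 by (simp add: Ld add_divide_distrib [symmetric])
  have "norm (cnj a * u - b * cnj u) \<le> (norm a + norm b) * norm u"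
    by (rule order_trans [OF norm_triangle_ineq4]) (simp add: norm_mult algebra_simps)
  then show "norm (L u) \<le> (norm a + norm b) / \<bar>(norm a)\<^sup>2 - (norm b)\<^sup>2\<bar> * norm u"
    unfolding d_def [symmetric] using d0 by (simp add: Ld norm_divide divide_right_mono)
  show "L (u - v) = L u - L v"
    by (simp add: Ld right_diff_distrib flip: diff_divide_distrib)
  show "bounded_linear L"
    unfolding Ld [abs_def]
    by (intro bounded_linear_compose [OF bounded_linear_divide] bounded_linear_sub
        bounded_linear_mult_right bounded_linear_compose [OF bounded_linear_mult_right bounded_linear_cnj])
qed

lemma tendsto_nhds_of_continuous_on_UNIV:
  "continuous_on UNIV f \<Longrightarrow> (f \<longlongrightarrow> f x) (nhds x)"
  by (rule continuous_on_tendsto_compose [of UNIV f "\<lambda>x. x"]) (auto simp: filterlim_ident)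

section \<open>Persistence of regular zeros in a one-parameter family\<close>

text \<open>\<open>A t\<close> and \<open>B t\<close> are the Wirtinger derivatives of
  \<open>F t\<close> with respect to \<open>z\<close> and \<open>cnj z\<close>. A zero is regular
  when they differ in modulus, that is, when the real Jacobian \<open>|A|^2 - |B|^2\<close> is
  nonzero there.\<close>

locale harmonic_family =
  fixes F A B :: "real \<Rightarrow> complex \<Rightarrow> complex"
  assumes contF: "continuous_on UNIV (\<lambda>x. F (fst x) (snd x))"
    and contA: "continuous_on UNIV (\<lambda>x. A (fst x) (snd x))"
    and contB: "continuous_on UNIV (\<lambda>x. B (fst x) (snd x))"
    and deriv: "(F t has_derivative (\<lambda>h. A t z * h + B t z * cnj h)) (at z)"
begin

text \<open>The iteration map is the simplified Newton map \<open>z \<mapsto> z - L (F t z)\<close>, where \<open>L\<close> inverts the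
  real derivative of \<open>F 0\<close> at \<open>p\<close>; it contracts a small disc around \<open>p\<close>.\<close>

lemma unique_zero_near_regular_zero:
  assumes zero: "F 0 p = 0" and regular: "norm (A 0 p) \<noteq> norm (B 0 p)"
  shows "\<forall>\<^sub>F r in at_right 0. \<forall>\<^sub>F t in nhds 0.
    (\<exists>!z. z \<in> cball p r \<and> F t z = 0) \<and> (\<forall>z\<in>cball p r. norm (A t z) \<noteq> norm (B t z))"
proof -
  define L where "L = (\<lambda>u. (cnj (A 0 p) * u - B 0 p * cnj u)
    / of_real ((norm (A 0 p))\<^sup>2 - (norm (B 0 p))\<^sup>2))"
  note L = harmonic_inverse_linear [OF regular L_def]
  \<comment> \<open>\<open>C\<close> bounds the operator norm of \<open>L\<close>. If
    \<open>A\<close> and \<open>B\<close> each vary by at most \<open>1 / (4 * C)\<close>, the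
    derivative of the Newton map has norm at most \<open>2 * C / (4 * C) = 1 / 2\<close>. If also
    \<open>norm (F t p) < r / (2 * C)\<close>, the centre moves by at most \<open>r / 2\<close>, so
    the disc of radius \<open>r\<close> is mapped into itself.\<close>
  define C where "C = (norm (A 0 p) + norm (B 0 p)) / \<bar>(norm (A 0 p))\<^sup>2 - (norm (B 0 p))\<^sup>2\<bar>"
  have "norm (A 0 p) + norm (B 0 p) > 0"
    using regular by (smt (verit) norm_ge_zero)
  then have C: "C > 0"
    using regular by (simp add: C_def power2_eq_iff_nonneg)
  have LC: "norm (L u) \<le> C * norm u" for u
    unfolding C_def by (rule L(3))
  have lim: "((\<lambda>x. A (fst x) (snd x)) \<longlongrightarrow> A 0 p) (nhds (0, p))"
    "((\<lambda>x. B (fst x) (snd x)) \<longlongrightarrow> B 0 p) (nhds (0, p))"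
    using tendsto_nhds_of_continuous_on_UNIV [OF contA, of "(0, p)"]
      tendsto_nhds_of_continuous_on_UNIV [OF contB, of "(0, p)"] by simp_all
  have "\<forall>\<^sub>F x in nhds (0, p). dist (A (fst x) (snd x)) (A 0 p) < 1 / (4 * C) \<and>
      dist (B (fst x) (snd x)) (B 0 p) < 1 / (4 * C) \<and>
      norm (A (fst x) (snd x)) - norm (B (fst x) (snd x)) \<noteq> 0"
    using C regular
    by (intro eventually_conj tendstoD [OF lim(1)] tendstoD [OF lim(2)]
        tendsto_imp_eventually_ne [OF tendsto_diff [OF tendsto_norm [OF lim(1)] tendsto_norm [OF lim(2)]]]) auto
  then obtain e where e: "e > 0"
    and near: "\<And>x. dist x (0, p) < e \<Longrightarrow> dist (A (fst x) (snd x)) (A 0 p) < 1 / (4 * C) \<and>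
      dist (B (fst x) (snd x)) (B 0 p) < 1 / (4 * C) \<and>
      norm (A (fst x) (snd x)) - norm (B (fst x) (snd x)) \<noteq> 0"
    unfolding eventually_nhds_metric by blast
  have near': "norm (A t z - A 0 p) \<le> 1 / (4 * C) \<and> norm (B t z - B 0 p) \<le> 1 / (4 * C) \<and>
      norm (A t z) \<noteq> norm (B t z)"
    if "\<bar>t\<bar> < e / 2" "dist z p \<le> e / 2" for t z
  proof -
    have "dist (t, z) (0, p) \<le> \<bar>t\<bar> + dist z p"
      unfolding dist_Pair_Pair by (rule order_trans [OF sqrt_sum_squares_le_sum]) auto
    then have "dist (t, z) (0, p) < e" using that by linarith
    from near [OF this] show ?thesis by (auto simp: dist_norm)
  qed
  have main: "\<forall>\<^sub>F t in nhds 0.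
    (\<exists>!z. z \<in> cball p r \<and> F t z = 0) \<and> (\<forall>z\<in>cball p r. norm (A t z) \<noteq> norm (B t z))"
    if r: "0 < r" "r \<le> e / 2" for r
  proof -
    have "continuous_on UNIV (\<lambda>t. F t p)"
      using continuous_on_compose2 [OF contF, of UNIV "\<lambda>t. (t, p)"]
      by (simp add: continuous_on_Pair)
    then have "((\<lambda>t. F t p) \<longlongrightarrow> F 0 p) (nhds 0)"
      by (rule tendsto_nhds_of_continuous_on_UNIV)
    from tendstoD [OF this, of "r / (2 * C)"]
    have small: "\<forall>\<^sub>F t in nhds 0. norm (F t p) < r / (2 * C)"
      using zero r C by simp
    have "\<forall>\<^sub>F t in nhds 0. \<bar>t\<bar> < e / 2"
      using e unfolding eventually_nhds_metric by (intro exI [of _ "e / 2"]) auto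
    with small show ?thesis
    proof eventually_elim
      case (elim t)
      define T where "T = (\<lambda>z. z - L (F t z))"
      have derT: "(T has_derivative (\<lambda>h. h - L (A t z * h + B t z * cnj h))) (at z within cball p r)" for z
        unfolding T_def
        by (intro has_derivative_diff has_derivative_ident bounded_linear.has_derivative [OF L(5)]
            has_derivative_at_withinI [OF deriv])
      have on: "onorm (\<lambda>h. h - L (A t z * h + B t z * cnj h)) \<le> 1 / 2" if z: "z \<in> cball p r" for z
      proof (rule onorm_le)
        fix h
        have bd: "norm (A t z - A 0 p) \<le> 1 / (4 * C)" "norm (B t z - B 0 p) \<le> 1 / (4 * C)"
          using near' [of t z] elim z r by (auto simp: dist_commute)
        \<comment> \<open>Since \<open>L\<close> inverts the derivative at \<open>(0, p)\<close>,
          \<open>h\<close> itself is a value of \<open>L\<close>, and only the variation of the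
          derivative remains.\<close>
        have "h - L (A t z * h + B t z * cnj h)
            = L ((A 0 p * h + B 0 p * cnj h) - (A t z * h + B t z * cnj h))"
          unfolding L(4) by (simp add: L(1))
        also have "norm \<dots> \<le> C * norm ((A 0 p * h + B 0 p * cnj h) - (A t z * h + B t z * cnj h))"
          by (rule LC)
        also have "(A 0 p * h + B 0 p * cnj h) - (A t z * h + B t z * cnj h)
            = - ((A t z - A 0 p) * h + (B t z - B 0 p) * cnj h)"
          by (simp add: algebra_simps)
        also have "norm \<dots> \<le> norm (A t z - A 0 p) * norm h + norm (B t z - B 0 p) * norm h"
          unfolding norm_minus_cancel by (rule order_trans [OF norm_triangle_ineq]) (simp add: norm_mult)
        also have "\<dots> \<le> 1 / (4 * C) * norm h + 1 / (4 * C) * norm h"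
          by (intro add_mono mult_right_mono bd) auto
        finally show "norm (h - L (A t z * h + B t z * cnj h)) \<le> 1 / 2 * norm h"
          using C by (simp add: field_simps)
      qed
      have lip: "dist (T x) (T y) \<le> 1 / 2 * dist x y" if "x \<in> cball p r" "y \<in> cball p r" for x y
        using differentiable_bound [OF convex_cball derT on that] by (simp add: dist_norm)
      have "dist (T p) p = norm (L (F t p))"
        by (simp add: T_def dist_norm)
      also have "\<dots> \<le> C * norm (F t p)"
        by (rule LC)
      also have "\<dots> \<le> r / 2"
        using elim C by (simp add: field_simps)
      finally have Tp: "dist (T p) p \<le> r / 2" .
      have self: "T ` cball p r \<subseteq> cball p r"
      proof
        fix y assume "y \<in> T ` cball p r"
        then obtain x where x: "x \<in> cball p r" "y = T x" by blast
        have "dist (T x) p \<le> dist (T x) (T p) + dist (T p) p" by (rule dist_triangle)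
        also have "\<dots> \<le> 1 / 2 * dist x p + r / 2"
          using lip [OF x(1), of p] r Tp by simp
        also have "\<dots> \<le> r" using x(1) by (simp add: dist_commute)
        finally show "y \<in> cball p r" using x by (simp add: dist_commute)
      qed
      have "\<exists>!z. z \<in> cball p r \<and> T z = z"
        using Banach_fix [of "cball p r" "1/2" T] self lip r
        by (force simp: complete_eq_closed)
      moreover have "T z = z \<longleftrightarrow> F t z = 0" for z
      proof
        assume "T z = z"
        then have "L (F t z) = 0" by (simp add: T_def)
        then show "F t z = 0" using L(2) [of "F t z"] by simp
      qed (simp add: T_def L_def)
      ultimately show ?case
        using near' [of t] elim r by (auto simp: dist_commute)
    qed
  qed
  show ?thesis
    unfolding eventually_at_right_field using e main by (intro exI [of _ "e / 2"]) auto
qed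

text \<open>The zeros \<open>(t, z)\<close> with \<open>|t| \<le> 1\<close> and
  \<open>z \<in> K\<close> form a compact set, so their projection to the parameter axis is closed;
  it misses 0 and hence a neighbourhood of 0.\<close>

lemma no_zeros_persist:
  assumes "compact K" "\<And>z. z \<in> K \<Longrightarrow> F 0 z \<noteq> 0"
  shows "\<forall>\<^sub>F t in nhds 0. \<forall>z\<in>K. F t z \<noteq> 0"
proof -
  define Z where "Z = (cball 0 1 \<times> K) \<inter> (\<lambda>x. F (fst x) (snd x)) -` {0}"
  have "closed ((\<lambda>x. F (fst x) (snd x)) -` {0})"
    using contF by (intro closed_vimage) (auto simp: continuous_on_eq_continuous_within)
  then have "compact Z"
    unfolding Z_def using assms(1) by (intro compact_Int_closed compact_Times) auto
  then have "closed (fst ` Z)"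
    by (intro compact_imp_closed compact_continuous_image continuous_on_fst continuous_on_id)
  moreover have "0 \<notin> fst ` Z"
    using assms(2) by (auto simp: Z_def)
  ultimately have "\<forall>\<^sub>F t in nhds 0. t \<in> - fst ` Z"
    by (intro eventually_nhds_in_open) auto
  moreover have "\<forall>\<^sub>F t in nhds (0::real). t \<in> ball 0 1"
    by (intro eventually_nhds_in_open) auto
  ultimately show ?thesis
    by eventually_elim (force simp: Z_def image_iff)
qed

text \<open>Disjoint closed discs inside \<open>K\<close> around the points of \<open>S\<close> each
  keep exactly one zero, and removing the open discs leaves a compact set that stays free of zeros.
  So no zero of \<open>F t\<close> in \<open>K\<close> is lost or gained.\<close>

lemma zeros_persist:
  assumes K: "compact K" and S: "S = {z \<in> K. F 0 z = 0}" "finite S" "S \<subseteq> interior K"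
    and regular: "\<And>z. z \<in> S \<Longrightarrow> norm (A 0 z) \<noteq> norm (B 0 z)"
  shows "\<forall>\<^sub>F t in nhds 0. finite {z \<in> K. F t z = 0} \<and> card {z \<in> K. F t z = 0} = card S \<and>
    (\<forall>z\<in>{z \<in> K. F t z = 0}. norm (A t z) \<noteq> norm (B t z))"
proof -
  let ?ok = "\<lambda>p r t. (\<exists>!z. z \<in> cball p r \<and> F t z = 0) \<and> (\<forall>z\<in>cball p r. norm (A t z) \<noteq> norm (B t z))"
  have "\<forall>\<^sub>F r in at_right 0. cball p r \<subseteq> K \<and> (\<forall>\<^sub>F t in nhds 0. ?ok p r t) \<and>
      (\<forall>q\<in>S. q \<noteq> p \<longrightarrow> cball p r \<inter> cball q r = {})" if p: "p \<in> S" for p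
  proof (intro eventually_conj eventually_ball_finite S(2) ballI)
    obtain e where e: "e > 0" "cball p e \<subseteq> K"
      using p S(3) by (meson mem_interior_cball subsetD)
    then show "\<forall>\<^sub>F r in at_right 0. cball p r \<subseteq> K"
      unfolding eventually_at_right_field by (intro exI [of _ e]) auto
    show "\<forall>\<^sub>F r in at_right 0. \<forall>\<^sub>F t in nhds 0. ?ok p r t"
      by (rule unique_zero_near_regular_zero) (use p S regular in auto)
    fix q assume "q \<in> S"
    show "\<forall>\<^sub>F r in at_right 0. q \<noteq> p \<longrightarrow> cball p r \<inter> cball q r = {}"
    proof (cases "q = p")
      case False
      have "cball p r \<inter> cball q r = {}" if "r < dist p q / 2" for r
      proof -
        have False if "dist p x \<le> r" "dist q x \<le> r" for x
          using dist_triangle2 [of p q x] that \<open>r < dist p q / 2\<close> by linarith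
        then show ?thesis by auto
      qed
      then show ?thesis
        unfolding eventually_at_right_field using False by (intro exI [of _ "dist p q / 2"]) auto
    qed auto
  qed
  then have "\<forall>\<^sub>F r in at_right 0. r > 0 \<and> (\<forall>p\<in>S. cball p r \<subseteq> K \<and> (\<forall>\<^sub>F t in nhds 0. ?ok p r t) \<and>
      (\<forall>q\<in>S. q \<noteq> p \<longrightarrow> cball p r \<inter> cball q r = {}))"
    by (intro eventually_conj eventually_at_right_less eventually_ball_finite S(2)) auto
  \<comment> \<open>Each requirement holds for all small radii, so the finitely many zeros admit one
    common radius.\<close>
  then obtain r where r: "r > 0" "\<And>p. p \<in> S \<Longrightarrow> cball p r \<subseteq> K"
    "\<And>p. p \<in> S \<Longrightarrow> \<forall>\<^sub>F t in nhds 0. ?ok p r t"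
    "\<And>p q. p \<in> S \<Longrightarrow> q \<in> S \<Longrightarrow> q \<noteq> p \<Longrightarrow> cball p r \<inter> cball q r = {}"
    by (auto dest!: eventually_happens' [OF trivial_limit_at_right_real])
  have "\<forall>\<^sub>F t in nhds 0. \<forall>z\<in>K - (\<Union>p\<in>S. ball p r). F t z \<noteq> 0"
  proof (rule no_zeros_persist)
    show "compact (K - (\<Union>p\<in>S. ball p r))"
      using K by (intro compact_diff) auto
    show "F 0 z \<noteq> 0" if "z \<in> K - (\<Union>p\<in>S. ball p r)" for z
      using that r(1) S(1) by auto
  qed
  moreover have "\<forall>\<^sub>F t in nhds 0. \<forall>p\<in>S. ?ok p r t"
    using r(3) by (intro eventually_ball_finite S(2)) auto
  ultimately show ?thesis
  proof eventually_elim
    case (elim t)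
    let ?Z = "{z \<in> K. F t z = 0}"
    have "\<forall>p\<in>S. \<exists>z. z \<in> cball p r \<and> F t z = 0"
      using elim(2) by blast
    then obtain g where g: "\<And>p. p \<in> S \<Longrightarrow> g p \<in> cball p r" "\<And>p. p \<in> S \<Longrightarrow> F t (g p) = 0"
      by metis
    have cover: "\<exists>p\<in>S. z \<in> cball p r" if "z \<in> ?Z" for z
    proof -
      have "z \<in> (\<Union>p\<in>S. ball p r)" using elim(1) that by blast
      then show ?thesis using ball_subset_cball by blast
    qed
    \<comment> \<open>\<open>g\<close> sends an old zero to its continuation: disjointness of the
      discs gives injectivity, and covering together with uniqueness in each disc gives
      surjectivity.\<close>
    have "bij_betw g S ?Z"
    proof (rule bij_betw_imageI)
      show "inj_on g S"
        using g(1) r(4) by (intro inj_onI) (metis disjoint_iff)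
      show "g ` S = ?Z"
      proof
        show "g ` S \<subseteq> ?Z" using g r(2) by blast
        show "?Z \<subseteq> g ` S"
        proof
          fix z assume z: "z \<in> ?Z"
          with cover obtain p where "p \<in> S" "z \<in> cball p r" by blast
          with elim(2) g z have "z = g p" by blast
          with \<open>p \<in> S\<close> show "z \<in> g ` S" by blast
        qed
      qed
    qed
    then have "finite ?Z" "card ?Z = card S"
      using S(2) bij_betw_finite bij_betw_same_card by metis+
    with cover elim(2) show ?case by blast
  qed
qed

end

section \<open>Harmonic polynomials, their Wirtinger derivatives and scaling\<close>

text \<open>This is the monomial \<open>e k\<close> of the overview.\<close>

definition harm_mono :: "nat \<Rightarrow> complex \<Rightarrow> complex" where
  "harm_mono k z = (if even k then z ^ k else cnj z ^ k)"

text \<open>The two sums of \<open>harmP\<close> are merged into one indexed by degree, so that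
  passing from \<open>n\<close> to \<open>Suc n\<close> adds a single term.\<close>

definition harm_sum :: "nat \<Rightarrow> (nat \<Rightarrow> complex) \<Rightarrow> complex \<Rightarrow> complex" where
  "harm_sum n c z = (\<Sum>k=1..n. c k * harm_mono k z)"

definition harm_dz :: "nat \<Rightarrow> (nat \<Rightarrow> complex) \<Rightarrow> complex \<Rightarrow> complex" where
  "harm_dz n c z = (\<Sum>k=1..n. c k * (if even k then of_nat k * z ^ (k - 1) else 0))"

definition harm_dzbar :: "nat \<Rightarrow> (nat \<Rightarrow> complex) \<Rightarrow> complex \<Rightarrow> complex" where
  "harm_dzbar n c z = (\<Sum>k=1..n. c k * (if even k then 0 else of_nat k * cnj z ^ (k - 1)))"

lemma harm_sum_cong:
  assumes "\<And>k. k \<in> {1..n} \<Longrightarrow> c k = d k"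
  shows "harm_sum n c = harm_sum n d" "harm_dz n c = harm_dz n d" "harm_dzbar n c = harm_dzbar n d"
  using assms by (auto simp: fun_eq_iff harm_sum_def harm_dz_def harm_dzbar_def intro!: sum.cong)

lemma harm_sum_Suc:
  "harm_sum (Suc n) c z = harm_sum n c z + c (Suc n) * harm_mono (Suc n) z"
  "harm_dz (Suc n) c z = harm_dz n c z + c (Suc n) * (if even (Suc n) then of_nat (Suc n) * z ^ n else 0)"
  "harm_dzbar (Suc n) c z = harm_dzbar n c z + c (Suc n) * (if even (Suc n) then 0 else of_nat (Suc n) * cnj z ^ n)"
  by (simp_all add: harm_sum_def harm_dz_def harm_dzbar_def)

lemma harm_sum_vanishing:
  assumes "\<And>k. k \<in> {1..n} \<Longrightarrow> c k = 0"
  shows "harm_sum n c z = 0" "harm_dz n c z = 0" "harm_dzbar n c z = 0"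
  using assms by (auto simp: harm_sum_def harm_dz_def harm_dzbar_def intro!: sum.neutral)

lemma norm_harm_mono: "norm (harm_mono k z) = norm z ^ k"
  by (simp add: harm_mono_def norm_power)

lemma harmP_eq_harm_sum: "harmP n a z = harm_sum n a z"
proof (induction n)
  case 0
  show ?case by (simp add: harmP_def harm_sum_def)
next
  case (Suc n)
  show ?case
  proof (cases "even n")
    case True
    then obtain m where "n = 2 * m" by (elim evenE)
    with Suc.IH show ?thesis by (simp add: harmP_def harm_sum_def harm_mono_def)
  next
    case False
    then obtain m where "n = 2 * m + 1" by (elim oddE)
    with Suc.IH show ?thesis by (simp add: harmP_def harm_sum_def harm_mono_def)
  qed
qed

lemma has_derivative_harm_sum:
  "(harm_sum n c has_derivative (\<lambda>h. harm_dz n c z * h + harm_dzbar n c z * cnj h)) (at z)"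
proof -
  have der: "((\<lambda>z. c k * harm_mono k z) has_derivative
      (\<lambda>h. c k * (if even k then of_nat k * z ^ (k - 1) else 0) * h
        + c k * (if even k then 0 else of_nat k * cnj z ^ (k - 1)) * cnj h)) (at z)" for k
    unfolding harm_mono_def
    by (cases "even k")
      (auto intro!: derivative_eq_intros bounded_linear.has_derivative [OF bounded_linear_cnj]
        simp: algebra_simps)
  have "((\<lambda>z. \<Sum>k=1..n. c k * harm_mono k z) has_derivative
      (\<lambda>h. \<Sum>k=1..n. c k * (if even k then of_nat k * z ^ (k - 1) else 0) * h
        + c k * (if even k then 0 else of_nat k * cnj z ^ (k - 1)) * cnj h)) (at z)"
    by (intro has_derivative_sum der)
  then show ?thesis
    by (simp only: harm_sum_def [abs_def] harm_dz_def harm_dzbar_def sum.distrib sum_distrib_right)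
qed

lemma harmonic_family_harm_sum:
  assumes "\<And>k. k \<in> {1..n} \<Longrightarrow> continuous_on UNIV (\<lambda>t. c t k)"
  shows "harmonic_family (\<lambda>t. harm_sum n (c t)) (\<lambda>t. harm_dz n (c t)) (\<lambda>t. harm_dzbar n (c t))"
proof
  have c: "continuous_on UNIV (\<lambda>x. c (fst x) k)" if "k \<in> {1..n}" for k
    using continuous_on_compose2 [OF assms [OF that], of UNIV fst]
    by (simp add: continuous_on_fst)
  show "continuous_on UNIV (\<lambda>x. harm_sum n (c (fst x)) (snd x))"
    unfolding harm_sum_def harm_mono_def
    by (rule continuous_on_sum, rename_tac k, case_tac "even k") (auto intro!: continuous_intros c)
  show "continuous_on UNIV (\<lambda>x. harm_dz n (c (fst x)) (snd x))"
    unfolding harm_dz_def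
    by (rule continuous_on_sum, rename_tac k, case_tac "even k") (auto intro!: continuous_intros c)
  show "continuous_on UNIV (\<lambda>x. harm_dzbar n (c (fst x)) (snd x))"
    unfolding harm_dzbar_def
    by (rule continuous_on_sum, rename_tac k, case_tac "even k") (auto intro!: continuous_intros c)
qed (rule has_derivative_harm_sum)

text \<open>Scaling by a real factor commutes with conjugation, so both kinds of monomial scale
  alike; the extra factor \<open>t\<close> on the derivatives comes from the chain rule.\<close>

lemma harm_sum_scale:
  assumes "\<And>k. k \<in> {1..n} \<Longrightarrow> c k * of_real t ^ k = s * b k"
  shows "harm_sum n c (of_real t * z) = s * harm_sum n b z"
    and "of_real t * harm_dz n c (of_real t * z) = s * harm_dz n b z"
    and "of_real t * harm_dzbar n c (of_real t * z) = s * harm_dzbar n b z"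
proof -
  have t: "of_real t * (c k * (of_real t) ^ (k - 1)) = s * b k" if "k \<in> {1..n}" for k
    using assms [OF that] that by (cases k) (auto simp: algebra_simps)
  have "c k * harm_mono k (of_real t * z) = s * (b k * harm_mono k z)" if "k \<in> {1..n}" for k
    by (simp add: harm_mono_def power_mult_distrib assms [OF that] flip: mult.assoc)
  then show "harm_sum n c (of_real t * z) = s * harm_sum n b z"
    unfolding harm_sum_def sum_distrib_left by (intro sum.cong) auto
  have "of_real t * (c k * (of_nat k * (of_real t * z) ^ (k - 1))) = s * (b k * (of_nat k * z ^ (k - 1)))"
    if "k \<in> {1..n}" for k z
  proof -
    have "of_real t * (c k * (of_nat k * (of_real t * z) ^ (k - 1)))
        = (of_real t * (c k * (of_real t) ^ (k - 1))) * (of_nat k * z ^ (k - 1))"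
      by (simp only: power_mult_distrib mult_ac)
    then show ?thesis by (simp only: mult.assoc t [OF that])
  qed
  then show "of_real t * harm_dz n c (of_real t * z) = s * harm_dz n b z"
    and "of_real t * harm_dzbar n c (of_real t * z) = s * harm_dzbar n b z"
    unfolding harm_dz_def harm_dzbar_def sum_distrib_left
    by (intro sum.cong; simp)+
qed

lemma norm_harm_sum_le:
  assumes "norm z \<ge> 1"
  shows "norm (harm_sum n c z) \<le> (\<Sum>k=1..n. norm (c k)) * norm z ^ n"
  unfolding harm_sum_def sum_distrib_right
proof (rule sum_norm_le)
  fix k assume "k \<in> {1..n}"
  then show "norm (c k * harm_mono k z) \<le> norm (c k) * norm z ^ n"
    using assms by (auto simp: norm_mult norm_harm_mono intro!: mult_left_mono power_increasing)
qed

section \<open>Zeros of the limiting binomial\<close>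

lemma norm_eq_of_binomial_zero:
  assumes "z \<noteq> 0" "c * harm_mono n z + harm_mono (Suc n) z = 0"
  shows "norm z = norm c"
proof -
  have "harm_mono (Suc n) z = - (c * harm_mono n z)"
    using assms(2) by (simp add: add_eq_0_iff)
  then have "norm z ^ Suc n = norm c * norm z ^ n"
    by (metis norm_harm_mono norm_minus_cancel norm_mult)
  then show ?thesis using assms(1) by simp
qed

text \<open>On the circle \<open>|z| = |c|\<close>, multiplying by \<open>z ^ n\<close> turns the equation into an equation for
  \<open>z ^ (2 * n + 1)\<close>.\<close>

lemma binomial_zeros_eq:
  assumes "c \<noteq> 0"
  shows "{z. z \<noteq> 0 \<and> c * cnj z ^ n + z ^ Suc n = 0}
    = {z. z ^ (2 * n + 1) = - (c * of_real (norm c) ^ (2 * n))}" (is "?L = ?R")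
proof -
  have key: "z ^ n * (c * cnj z ^ n + z ^ Suc n) = z ^ (2 * n + 1) + c * of_real (norm c) ^ (2 * n)"
    if "norm z = norm c" for z
  proof -
    have "z ^ n * cnj z ^ n = of_real (norm c) ^ (2 * n)"
      unfolding power_mult_distrib [symmetric] complex_norm_square [symmetric] that
      by (simp add: power_mult)
    moreover have "z ^ (2 * n + 1) = z ^ n * z ^ Suc n"
      by (simp add: power_add mult_2)
    moreover have "z ^ n * (c * cnj z ^ n + z ^ Suc n) = c * (z ^ n * cnj z ^ n) + z ^ n * z ^ Suc n"
      by (simp only: distrib_left mult_ac)
    ultimately show ?thesis
      by (simp only: add.commute)
  qed
  have "norm z = norm c" if "z \<in> ?L" for z
  proof -
    have "z ^ Suc n = - (c * cnj z ^ n)"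
      using that by (simp add: add_eq_0_iff)
    then have "norm z ^ Suc n = norm c * norm z ^ n"
      by (metis complex_mod_cnj norm_minus_cancel norm_mult norm_power)
    then show ?thesis using that by simp
  qed
  moreover have "norm z = norm c" if "z \<in> ?R" for z
  proof -
    have "norm (z ^ (2 * n + 1)) = norm (- (c * of_real (norm c) ^ (2 * n)))"
      using that by (simp only: mem_Collect_eq)
    then have "norm z ^ (2 * n + 1) = norm c ^ (2 * n + 1)"
      by (simp add: norm_mult norm_power)
    then show ?thesis
      by (rule power_eq_imp_eq_base) auto
  qed
  moreover have "0 \<notin> ?R"
    using assms by simp
  moreover have "z \<in> ?L \<longleftrightarrow> z \<in> ?R" if "norm z = norm c" for z
  proof -
    have "z \<noteq> 0" using that assms by auto
    then have "z \<in> ?L \<longleftrightarrow> z ^ n * (c * cnj z ^ n + z ^ Suc n) = 0" by simp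
    then show ?thesis unfolding key [OF that] by (simp only: mem_Collect_eq add_eq_0_iff2)
  qed
  ultimately show ?thesis
    by blast
qed

text \<open>For even \<open>n\<close> conjugating the equation brings it to the shape treated for
  odd \<open>n\<close>; what remains is counting the roots of order \<open>2 * n + 1\<close> of a
  nonzero number.\<close>

lemma card_binomial_zeros:
  assumes "c \<noteq> 0"
  shows "finite {z. z \<noteq> 0 \<and> c * harm_mono n z + harm_mono (Suc n) z = 0}" (is "finite ?S")
    and "card {z. z \<noteq> 0 \<and> c * harm_mono n z + harm_mono (Suc n) z = 0} = 2 * n + 1"
proof -
  have roots: "finite {z. z \<noteq> 0 \<and> d * cnj z ^ n + z ^ Suc n = 0}"
    "card {z. z \<noteq> 0 \<and> d * cnj z ^ n + z ^ Suc n = 0} = 2 * n + 1" if "d \<noteq> 0" for d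
    unfolding binomial_zeros_eq [OF that] using that
    by (intro finite_nth_roots card_nth_roots; simp)+
  have "?S = {z. z \<noteq> 0 \<and> (if even n then cnj c else c) * cnj z ^ n + z ^ Suc n = 0}"
  proof (cases "even n")
    case True
    have "c * z ^ n + cnj z ^ Suc n = 0 \<longleftrightarrow> cnj c * cnj z ^ n + z ^ Suc n = 0" for z
      by (subst complex_cnj_cancel_iff [symmetric]) simp
    with True show ?thesis by (simp add: harm_mono_def)
  qed (simp add: harm_mono_def)
  then show "finite ?S" "card ?S = 2 * n + 1"
    using roots [of "if even n then cnj c else c"] assms by auto
qed

section \<open>The induction step and the zero count\<close>

text \<open>The invariant of the induction. The set \<open>Z\<close> is a parameter so that the
  zeros inside a compact region can be treated separately.\<close>

definition regular_zeros :: "nat \<Rightarrow> (nat \<Rightarrow> complex) \<Rightarrow> complex set \<Rightarrow> bool" where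
  "regular_zeros n c Z \<longleftrightarrow> finite Z \<and> (\<forall>z\<in>Z. norm (harm_dz n c z) \<noteq> norm (harm_dzbar n c z))"

text \<open>For small \<open>t > 0\<close> the zeros split into those with
  \<open>|z| \<le> R\<close>, continuing the old ones, and those with
  \<open>\<delta> \<le> t * |z| \<le> M\<close>, continuing the nonzero zeros of the binomial after
  rescaling.\<close>

lemma extend_regular_zeros:
  assumes n: "n \<ge> 1" and an: "a n \<noteq> 0"
    and reg: "regular_zeros n a {z. harm_sum n a z = 0}"
  obtains \<epsilon> :: real where "\<epsilon> > 0"
    "regular_zeros (Suc n) (a(Suc n := of_real \<epsilon>)) {z. harm_sum (Suc n) (a(Suc n := of_real \<epsilon>)) z = 0}"
    "card {z. harm_sum (Suc n) (a(Suc n := of_real \<epsilon>)) z = 0} = card {z. harm_sum n a z = 0} + (2 * n + 1)"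
proof -
  obtain m where m: "n = Suc m" using n by (cases n) auto
  define s where "s = (\<Sum>k=1..n. norm (a k))"
  \<comment> \<open>With a third of \<open>norm (a n)\<close>, two error terms of size at most
    \<open>\<delta> * |z| ^ n\<close> cannot cancel the term of degree \<open>n\<close>.
    \<open>R\<close> is large enough for the lower terms to be one such error, and \<open>M\<close>
    is a Cauchy-type bound on the zeros of the rescaled polynomials.\<close>
  define \<delta> where "\<delta> = norm (a n) / 3"
  define R where "R = 1 + s / \<delta>"
  define M where "M = 1 + s"
  define c where "c = (\<lambda>t::real. a(Suc n := of_real t))"
  define d where "d = (\<lambda>(t::real) k. if k = Suc n then 1 else a k * of_real t ^ (n - k))"
  have an_s: "norm (a n) \<le> s"
    unfolding s_def using n by (intro member_le_sum) auto
  have pos: "\<delta> > 0" "s > 0" "R > 1" "M > 1"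
    using an an_s by (auto simp: \<delta>_def R_def M_def intro!: add_pos_nonneg divide_pos_pos order.strict_trans2 [OF _ an_s])
  have s_R: "s < \<delta> * R"
    using pos by (simp add: R_def field_simps)

  txt \<open>\<open>d t\<close> are the coefficients of \<open>t ^ n * harm_sum (Suc n) (c t) (w / t)\<close> as a polynomial in \<open>w\<close>.\<close>
  have c0: "harm_sum (Suc n) (c 0) = harm_sum n a" "harm_dz (Suc n) (c 0) = harm_dz n a"
    "harm_dzbar (Suc n) (c 0) = harm_dzbar n a"
    using harm_sum_cong [of n "c 0" a] by (auto simp: fun_eq_iff harm_sum_Suc c_def)
  \<comment> \<open>This is the gap between the two groups of zeros. At \<open>t = 0\<close> it has
    no outer boundary, and thus confines all old zeros to \<open>ball 0 R\<close>.\<close>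
  have c_nz: "harm_sum (Suc n) (c t) z \<noteq> 0" if "0 \<le> t" "R \<le> norm z" "t * norm z < \<delta>" for t z
  proof
    have z1: "norm z \<ge> 1" using that(2) pos by linarith
    assume "harm_sum (Suc n) (c t) z = 0"
    then have "a n * harm_mono n z = - (harm_sum m (c t) z + of_real t * harm_mono (Suc n) z)"
      unfolding m harm_sum_Suc by (simp add: c_def m add_eq_0_iff algebra_simps)
    then have "norm (a n) * norm z ^ n = norm (harm_sum m (c t) z + of_real t * harm_mono (Suc n) z)"
      by (metis norm_harm_mono norm_minus_cancel norm_mult)
    also have "\<dots> \<le> norm (harm_sum m (c t) z) + norm (of_real t * harm_mono (Suc n) z)"
      by (rule norm_triangle_ineq)
    also have "norm (harm_sum m (c t) z) \<le> s * norm z ^ m"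
    proof (rule order_trans [OF norm_harm_sum_le [OF z1]], intro mult_right_mono)
      show "(\<Sum>k = 1..m. norm (c t k)) \<le> s"
        unfolding s_def m by (simp add: c_def m)
    qed auto
    also have "s * norm z ^ m \<le> (\<delta> * norm z) * norm z ^ m"
      using s_R that(2) pos by (intro mult_right_mono) (auto intro: order_trans [OF less_imp_le mult_left_mono])
    also have "norm (of_real t * harm_mono (Suc n) z) = (t * norm z) * norm z ^ n"
      using that(1) by (simp add: norm_mult norm_harm_mono)
    also have "\<dots> < \<delta> * norm z ^ n"
      using that(3) z1 by (intro mult_strict_right_mono zero_less_power) linarith+
    finally have "norm (a n) * norm z ^ n < (2 * \<delta>) * norm z ^ n"
      by (simp add: m algebra_simps)
    then have "norm (a n) < 2 * \<delta>"
      by (rule mult_right_less_imp_less) simp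
    then show False using pos by (simp add: \<delta>_def)
  qed
  interpret near: harmonic_family "\<lambda>t. harm_sum (Suc n) (c t)" "\<lambda>t. harm_dz (Suc n) (c t)"
    "\<lambda>t. harm_dzbar (Suc n) (c t)"
    by (rule harmonic_family_harm_sum, rename_tac k, case_tac "k = Suc n")
      (auto simp: c_def intro!: continuous_intros)
  have S1: "{z. harm_sum n a z = 0} \<subseteq> ball 0 R"
    using c_nz [of 0] pos unfolding c0 by force
  have near: "\<forall>\<^sub>F t in nhds 0. finite {z \<in> cball 0 R. harm_sum (Suc n) (c t) z = 0} \<and>
      card {z \<in> cball 0 R. harm_sum (Suc n) (c t) z = 0} = card {z. harm_sum n a z = 0} \<and>
      (\<forall>z\<in>{z \<in> cball 0 R. harm_sum (Suc n) (c t) z = 0}.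
        norm (harm_dz (Suc n) (c t) z) \<noteq> norm (harm_dzbar (Suc n) (c t) z))"
    using S1 reg unfolding regular_zeros_def
    by (intro near.zeros_persist) (auto simp: c0)

  \<comment> \<open>At \<open>t = 0\<close> the coefficients below degree \<open>n\<close> vanish,
    whereas \<open>0 ^ 0 = 1\<close> preserves \<open>a n\<close>.\<close>
  have "harm_sum m (d 0) z = 0" "harm_dz m (d 0) z = 0" "harm_dzbar m (d 0) z = 0" for z
    by (rule harm_sum_vanishing; simp add: d_def m)+
  then have d0: "harm_sum (Suc n) (d 0) z = a n * harm_mono n z + harm_mono (Suc n) z"
    "harm_dz (Suc n) (d 0) z = (if even n then a n * (of_nat n * z ^ m) else of_nat (Suc n) * z ^ n)"
    "harm_dzbar (Suc n) (d 0) z = (if even n then of_nat (Suc n) * cnj z ^ n else a n * (of_nat n * cnj z ^ m))" for z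
    unfolding m harm_sum_Suc by (simp_all add: d_def m)
  \<comment> \<open>The annulus cuts out the zero of the binomial at the origin, where the old zeros
    collapse under rescaling. It keeps the circle \<open>|w| = norm (a n)\<close> in its interior,
    as \<open>\<delta> < norm (a n) < M\<close>.\<close>
  define K where "K = cball (0::complex) M - ball 0 \<delta>"
  have d_nz: "norm w \<le> M" if t: "0 \<le> t" "t \<le> 1" and w: "harm_sum (Suc n) (d t) w = 0" for t w
  proof (rule ccontr)
    assume wM: "\<not> norm w \<le> M"
    then have w1: "norm w \<ge> 1" using pos by linarith
    have "harm_mono (Suc n) w = - harm_sum n (d t) w"
      using w by (simp add: harm_sum_Suc d_def add_eq_0_iff)
    then have "norm w ^ Suc n = norm (harm_sum n (d t) w)"
      by (metis norm_harm_mono norm_minus_cancel)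
    also have "\<dots> \<le> s * norm w ^ n"
    proof (rule order_trans [OF norm_harm_sum_le [OF w1]], intro mult_right_mono)
      show "(\<Sum>k = 1..n. norm (d t k)) \<le> s"
        unfolding s_def using t
        by (intro sum_mono) (auto simp: d_def norm_mult norm_power intro!: mult_left_le power_le_one)
    qed auto
    also have "\<dots> < norm w * norm w ^ n"
      using wM w1 by (intro mult_strict_right_mono zero_less_power) (unfold M_def, linarith+)
    finally show False by simp
  qed
  interpret far: harmonic_family "\<lambda>t. harm_sum (Suc n) (d t)" "\<lambda>t. harm_dz (Suc n) (d t)"
    "\<lambda>t. harm_dzbar (Suc n) (d t)"
    by (rule harmonic_family_harm_sum, rename_tac k, case_tac "k = Suc n")
      (auto simp: d_def intro!: continuous_intros)
  let ?S2 = "{z. z \<noteq> 0 \<and> a n * harm_mono n z + harm_mono (Suc n) z = 0}"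
  have norm_S2: "norm z = norm (a n)" if "z \<in> ?S2" for z
    using norm_eq_of_binomial_zero that by blast
  have far: "\<forall>\<^sub>F t in nhds 0. finite {z \<in> K. harm_sum (Suc n) (d t) z = 0} \<and>
      card {z \<in> K. harm_sum (Suc n) (d t) z = 0} = card ?S2 \<and>
      (\<forall>z\<in>{z \<in> K. harm_sum (Suc n) (d t) z = 0}.
        norm (harm_dz (Suc n) (d t) z) \<noteq> norm (harm_dzbar (Suc n) (d t) z))"
  proof (rule far.zeros_persist)
    show "compact K"
      unfolding K_def by (intro compact_diff) auto
    have "z \<in> ball 0 M - cball 0 \<delta>" if "z \<in> ?S2" for z
      using norm_S2 [OF that] an an_s by (auto simp: \<delta>_def M_def)
    then have "?S2 \<subseteq> ball 0 M - cball 0 \<delta>"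
      by blast
    also have "\<dots> \<subseteq> interior K"
      by (intro interior_maximal) (auto simp: K_def)
    finally show S2: "?S2 \<subseteq> interior K" .
    show "?S2 = {z \<in> K. harm_sum (Suc n) (d 0) z = 0}"
      using S2 interior_subset [of K] pos by (auto simp: d0 K_def)
    show "finite ?S2"
      by (rule card_binomial_zeros) (rule an)
    fix z assume z: "z \<in> ?S2"
    \<comment> \<open>Since \<open>|z| = norm (a n)\<close>, the two Wirtinger derivatives have
      moduli \<open>n * |z| ^ n\<close> and \<open>(n + 1) * |z| ^ n\<close> in some order.\<close>
    have an_z: "norm (a n) * norm z ^ m = norm z ^ n"
      using norm_S2 [OF z] by (simp add: m)
    have "real (Suc n) * norm z ^ n \<noteq> real n * norm z ^ n"
      using z by simp
    then show "norm (harm_dz (Suc n) (d 0) z) \<noteq> norm (harm_dzbar (Suc n) (d 0) z)"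
      unfolding d0 using an_z by (auto simp: norm_mult norm_power mult.left_commute simp del: of_nat_Suc)
  qed

  have "\<forall>\<^sub>F t in nhds 0. \<bar>t\<bar> < min 1 (\<delta> / R)"
    using pos unfolding eventually_nhds_metric by (intro exI [of _ "min 1 (\<delta> / R)"]) auto
  with near far have "\<forall>\<^sub>F t in nhds 0. regular_zeros (Suc n) (c t) {z \<in> cball 0 R. harm_sum (Suc n) (c t) z = 0} \<and>
      card {z \<in> cball 0 R. harm_sum (Suc n) (c t) z = 0} = card {z. harm_sum n a z = 0} \<and>
      regular_zeros (Suc n) (d t) {z \<in> K. harm_sum (Suc n) (d t) z = 0} \<and>
      card {z \<in> K. harm_sum (Suc n) (d t) z = 0} = 2 * n + 1 \<and> \<bar>t\<bar> < min 1 (\<delta> / R)"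
    unfolding regular_zeros_def card_binomial_zeros(2) [OF an]
    by eventually_elim blast
  then have "\<forall>\<^sub>F t in at_right 0. 0 < t \<and> regular_zeros (Suc n) (c t) {z \<in> cball 0 R. harm_sum (Suc n) (c t) z = 0} \<and>
      card {z \<in> cball 0 R. harm_sum (Suc n) (c t) z = 0} = card {z. harm_sum n a z = 0} \<and>
      regular_zeros (Suc n) (d t) {z \<in> K. harm_sum (Suc n) (d t) z = 0} \<and>
      card {z \<in> K. harm_sum (Suc n) (d t) z = 0} = 2 * n + 1 \<and> \<bar>t\<bar> < min 1 (\<delta> / R)"
    unfolding eventually_at_filter by eventually_elim auto
  \<comment> \<open>The bound \<open>t < 1\<close> makes \<open>d_nz\<close> applicable, and
    \<open>t * R < \<delta>\<close> keeps the scaled disc \<open>|z| \<le> R\<close> away from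
    \<open>K\<close>.\<close>
  then obtain t where t: "0 < t" "t < 1" "t < \<delta> / R"
    and regc: "regular_zeros (Suc n) (c t) {z \<in> cball 0 R. harm_sum (Suc n) (c t) z = 0}"
    and cardc: "card {z \<in> cball 0 R. harm_sum (Suc n) (c t) z = 0} = card {z. harm_sum n a z = 0}"
    and regd: "regular_zeros (Suc n) (d t) {z \<in> K. harm_sum (Suc n) (d t) z = 0}"
    and cardd: "card {z \<in> K. harm_sum (Suc n) (d t) z = 0} = 2 * n + 1"
    by (auto dest!: eventually_happens' [OF trivial_limit_at_right_real])
  have tR: "t * R < \<delta>" using t pos by (simp add: field_simps)
  have coeff: "d t k * of_real t ^ k = of_real t ^ n * c t k" if "k \<in> {1..Suc n}" for k
  proof (cases "k = Suc n")
    case False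
    then have "t ^ (n - k) * t ^ k = t ^ n"
      using that by (simp flip: power_add)
    then have "complex_of_real t ^ (n - k) * of_real t ^ k = of_real t ^ n"
      by (simp flip: of_real_power of_real_mult)
    with False show ?thesis by (simp add: d_def c_def mult.assoc)
  qed (simp add: d_def c_def)
  have scale: "harm_sum (Suc n) (d t) (of_real t * z) = of_real t ^ n * harm_sum (Suc n) (c t) z"
    "of_real t * harm_dz (Suc n) (d t) (of_real t * z) = of_real t ^ n * harm_dz (Suc n) (c t) z"
    "of_real t * harm_dzbar (Suc n) (d t) (of_real t * z) = of_real t ^ n * harm_dzbar (Suc n) (c t) z" for z
    using harm_sum_scale [OF coeff] by blast+

  let ?Z = "{z. harm_sum (Suc n) (c t) z = 0}"
  let ?Z1 = "{z \<in> cball 0 R. harm_sum (Suc n) (c t) z = 0}"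
  let ?Z2 = "{z. of_real t * z \<in> {w \<in> K. harm_sum (Suc n) (d t) w = 0}}"
  have bij: "bij_betw (\<lambda>z. of_real t * z) ?Z2 {w \<in> K. harm_sum (Suc n) (d t) w = 0}"
    using t by (intro bij_betw_byWitness [where f' = "\<lambda>w. w / of_real t"]) auto
  \<comment> \<open>A zero outside the disc has \<open>\<delta> \<le> t * |z|\<close> by the gap and
    \<open>t * |z| \<le> M\<close> by \<open>d_nz\<close>, so its rescaling lies in
    \<open>K\<close>.\<close>
  have "z \<in> ?Z1 \<union> ?Z2" if z: "z \<in> ?Z" for z
  proof (cases "norm z \<le> R")
    case False
    have "harm_sum (Suc n) (d t) (of_real t * z) = 0"
      using z by (simp add: scale)
    moreover have "\<delta> \<le> t * norm z"
      using c_nz [of t z] False z t by force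
    ultimately have "of_real t * z \<in> K"
      using d_nz [of t "of_real t * z"] t by (auto simp: K_def norm_mult)
    then show ?thesis using \<open>harm_sum (Suc n) (d t) (of_real t * z) = 0\<close> by simp
  qed (use z in simp)
  moreover have "?Z2 \<subseteq> ?Z"
    using t by (auto simp: scale)
  ultimately have Z: "?Z = ?Z1 \<union> ?Z2"
    by blast
  have "t * norm z < \<delta>" if "norm z \<le> R" for z :: complex
    using mult_left_mono [OF that, of t] t tR by linarith
  then have disj: "?Z1 \<inter> ?Z2 = {}"
    using t by (force simp: K_def norm_mult)
  have fin: "finite ?Z1" "finite ?Z2"
    using regc regd bij_betw_finite [OF bij] by (auto simp: regular_zeros_def)
  have "norm (harm_dz (Suc n) (c t) z) \<noteq> norm (harm_dzbar (Suc n) (c t) z)" if z: "z \<in> ?Z" for z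
  proof (cases "z \<in> ?Z1")
    case True
    then show ?thesis using regc by (simp add: regular_zeros_def)
  next
    case False
    then have "z \<in> ?Z2" using z Z by blast
    then have "norm (harm_dz (Suc n) (d t) (of_real t * z)) \<noteq> norm (harm_dzbar (Suc n) (d t) (of_real t * z))"
      using regd by (simp add: regular_zeros_def)
    then have "norm (of_real t * harm_dz (Suc n) (d t) (of_real t * z))
        \<noteq> norm (of_real t * harm_dzbar (Suc n) (d t) (of_real t * z))"
      using t by (simp add: norm_mult)
    then show ?thesis unfolding scale by (auto simp: norm_mult)
  qed
  then have "regular_zeros (Suc n) (c t) ?Z"
    using fin Z by (simp add: regular_zeros_def)
  moreover have "card ?Z = card {z. harm_sum n a z = 0} + (2 * n + 1)"
    unfolding Z card_Un_disjoint [OF fin disj] cardc bij_betw_same_card [OF bij] cardd ..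
  ultimately show thesis
    using that [of t] t unfolding c_def by blast
qed

theorem theorem4p1:
  fixes n :: nat
  assumes "n \<ge> 1"
  shows "\<exists>a :: nat \<Rightarrow> complex. (\<forall>i \<in> {1..n}. a i \<noteq> 0) \<and>
           finite {z. harmP n a z = 0} \<and> card {z. harmP n a z = 0} = n ^ 2"
proof -
  have "\<exists>a. (\<forall>i \<in> {1..n}. a i \<noteq> 0) \<and> regular_zeros n a {z. harm_sum n a z = 0} \<and>
      card {z. harm_sum n a z = 0} = n ^ 2"
    using assms
  proof (induction n rule: nat_induct_at_least)
    case base
    \<comment> \<open>The polynomial is \<open>cnj z\<close>; its only zero is regular because the
      Wirtinger derivatives are 0 and 1.\<close>
    have "{z. harm_sum 1 (\<lambda>_. 1) z = 0} = {0}"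
      by (simp add: harm_sum_def harm_mono_def)
    then show ?case
      by (intro exI [of _ "\<lambda>_. 1"]) (simp add: regular_zeros_def harm_dz_def harm_dzbar_def)
  next
    case (Suc n)
    then obtain a where a: "\<forall>i \<in> {1..n}. a i \<noteq> 0" "regular_zeros n a {z. harm_sum n a z = 0}"
      "card {z. harm_sum n a z = 0} = n ^ 2"
      by blast
    then have "a n \<noteq> 0" using Suc.hyps by simp
    from extend_regular_zeros [OF Suc.hyps this a(2)] obtain \<epsilon> :: real where \<epsilon>: "\<epsilon> > 0"
      "regular_zeros (Suc n) (a(Suc n := of_real \<epsilon>)) {z. harm_sum (Suc n) (a(Suc n := of_real \<epsilon>)) z = 0}"
      "card {z. harm_sum (Suc n) (a(Suc n := of_real \<epsilon>)) z = 0} = card {z. harm_sum n a z = 0} + (2 * n + 1)" .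
    have "\<forall>i \<in> {1..Suc n}. (a(Suc n := of_real \<epsilon>)) i \<noteq> 0"
      using a(1) \<epsilon>(1) by auto
    moreover have "n ^ 2 + (2 * n + 1) = Suc n ^ 2"
      by (simp add: power2_eq_square)
    ultimately show ?case
      using \<epsilon>(2,3) a(3) by metis
  qed
  then show ?thesis
    by (auto simp: harmP_eq_harm_sum regular_zeros_def)
qed

end
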